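(* Let $f=(a,b,c,d)$ and $g=(a',b',c',d')$ be quadruples of complex numbers with $ad-bc\neq 0$ and $a'd'-b'c'\neq 0$, and let $$f\circ g=(aa'+bc',\ ab'+bd',\ ca'+dc',\ cb'+dd').$$ Then for every $z\in\mathbb{C}_\infty$, $$(f\circ g)(z)=f(g(z)),$$ where each quadruple acts on $\mathbb{C}_\infty$ as a linear fractional transformation.
   Context: The extended complex plane is $\mathbb{C}_\infty=\mathbb{C}\cup\{\infty\}$, the disjoint union of $\mathbb{C}$ and one extra point $\infty$. A quadruple $f=(a,b,c,d)\in\mathbb{C}^4$ with $ad-bc\neq 0$ acts on $\mathbb{C}_\infty$ as follows. If $c=0$: $f(z)=(a/d)z+(b/d)$ for $z\in\mathbb{C}$ and $f(\infty)=\infty$. If $c\neq 0$: $f(z)=\frac{az+b}{cz+d}$ for $z\in\mathbb{C}$, $z\neq -d/c$; $f(-d/c)=\infty$; and $f(\infty)=a/c$. The quadruple $f\circ g$ also has nonzero determinant, equal to $(ad-bc)(a'd'-b'c')$, so it acts in the same way. *)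

theory Defs
  imports Complex_Main
begin

datatype ext_complex = Finite complex | Infinity

type_synonym quadruple = "complex \<times> complex \<times> complex \<times> complex"

fun qdet :: "quadruple \<Rightarrow> complex" where
  "qdet (a, b, c, d) = a * d - b * c"

(* Only meaningful for qdet f \<noteq> 0; in particular c = 0 then forces d \<noteq> 0, so no
   division below is by zero. *)
fun lft :: "quadruple \<Rightarrow> ext_complex \<Rightarrow> ext_complex" where
  "lft (a, b, c, d) (Finite z) =
     (if c = 0 then Finite ((a / d) * z + b / d)
      else if z = - d / c then Infinity
      else Finite ((a * z + b) / (c * z + d)))"
| "lft (a, b, c, d) Infinity =
     (if c = 0 then Infinity else Finite (a / c))"

fun qcomp :: "quadruple \<Rightarrow> quadruple \<Rightarrow> quadruple" where
  "qcomp (a, b, c, d) (a', b', c', d') =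
     (a * a' + b * c', a * b' + b * d', c * a' + d * c', c * b' + d * d')"

lemma qdet_qcomp: "qdet (qcomp f g) = qdet f * qdet g"
  by (cases f; cases g) (simp add: algebra_simps)

end

(* In homogeneous coordinates [x : y] a quadruple acts linearly, as a 2x2 matrix, and qcomp is
   the matrix product; an invertible matrix sends no nonzero vector to zero. *)
theory Submission
  imports Defs
begin

text \<open>Every point of the sphere is a ratio [x : y] with (x, y) nonzero. Once
  \<open>lft_hom_point\<close> identifies the action with matrix times vector, the cases for
  infinity and the pole disappear, and the claim is associativity of the matrix product applied to a
  vector. \<open>linear_image_nonzero\<close> ensures that the image under \<open>g\<close> is again
  a valid vector for \<open>f\<close>.\<close>

definition hom_point :: "complex \<Rightarrow> complex \<Rightarrow> ext_complex" where
  "hom_point x y = (if y = 0 then Infinity else Finite (x / y))"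

lemma hom_point_cases:
  obtains x y where "z = hom_point x y" "x \<noteq> 0 \<or> y \<noteq> 0"
proof (cases z)
  case (Finite w)
  then show ?thesis using that[of w 1] by (simp add: hom_point_def)
next
  case Infinity
  then show ?thesis using that[of 1 0] by (simp add: hom_point_def)
qed

text \<open>All the case analysis happens here. The vector must be nonzero:
  \<open>hom_point 0 0\<close> is \<open>Infinity\<close> by default, which for
  \<open>c \<noteq> 0\<close> would give \<open>a / c\<close> on the left but
  \<open>Infinity\<close> on the right.\<close>

lemma lft_hom_point:
  assumes det: "qdet (a, b, c, d) \<noteq> 0" and xy: "x \<noteq> 0 \<or> y \<noteq> 0"
  shows "lft (a, b, c, d) (hom_point x y) = hom_point (a * x + b * y) (c * x + d * y)"
proof (cases "y = 0")
  case True
  then show ?thesis using xy by (simp add: hom_point_def)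
next
  case y: False
  show ?thesis
  proof (cases "c = 0")
    case True
    then have "d \<noteq> 0" using det by auto
    then show ?thesis using True y by (simp add: hom_point_def field_simps)
  next
    case c: False
    \<comment> \<open>The pole is exactly where the second image coordinate vanishes, so the tests
      in \<open>lft\<close> and \<open>hom_point\<close> agree.\<close>
    have pole: "x / y = - d / c \<longleftrightarrow> c * x + d * y = 0"
      using c y by (simp add: field_simps eq_neg_iff_add_eq_0)
    \<comment> \<open>The factor \<open>1 / y\<close> cancels; at the pole both quotients are 0,
      since division by zero gives 0.\<close>
    have "(a * (x / y) + b) / (c * (x / y) + d) = (a * x + b * y) / (c * x + d * y)"
    proof -
      have "a * (x / y) + b = (a * x + b * y) / y" "c * (x / y) + d = (c * x + d * y) / y"
        using y by (simp_all add: field_simps)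
      then show ?thesis using y by simp
    qed
    then show ?thesis using c y pole by (simp add: hom_point_def)
  qed
qed

text \<open>Applying the adjugate matrix to the image vector returns the determinant times (x, y),
  so the kernel is trivial.\<close>

lemma linear_image_nonzero:
  assumes det: "qdet (a, b, c, d) \<noteq> 0" and xy: "x \<noteq> 0 \<or> y \<noteq> 0"
  shows "a * x + b * y \<noteq> 0 \<or> c * x + d * y \<noteq> 0"
proof (rule ccontr)
  assume "\<not> ?thesis"
  then have 0: "a * x + b * y = 0" "c * x + d * y = 0" by auto
  have "qdet (a, b, c, d) * x = d * (a * x + b * y) - b * (c * x + d * y)"
    "qdet (a, b, c, d) * y = a * (c * x + d * y) - c * (a * x + b * y)"
    by (simp_all add: algebra_simps)
  then show False using det xy unfolding 0 by auto
qed

theorem mainTheorem5: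
  fixes f g :: quadruple and z :: ext_complex
  assumes "qdet f \<noteq> 0" and "qdet g \<noteq> 0"
  shows "lft (qcomp f g) z = lft f (lft g z)"
proof -
  obtain a b c d where f: "f = (a, b, c, d)" by (cases f)
  obtain a' b' c' d' where g: "g = (a', b', c', d')" by (cases g)
  obtain x y where z: "z = hom_point x y" and xy: "x \<noteq> 0 \<or> y \<noteq> 0"
    by (rule hom_point_cases)
  have det: "qdet (qcomp f g) \<noteq> 0" using assms by (simp add: qdet_qcomp)
  have "lft (qcomp f g) z = hom_point ((a * a' + b * c') * x + (a * b' + b * d') * y)
      ((c * a' + d * c') * x + (c * b' + d * d') * y)"
    using lft_hom_point[OF det[unfolded f g qcomp.simps] xy] by (simp only: f g z qcomp.simps)
  also have "\<dots> = hom_point (a * (a' * x + b' * y) + b * (c' * x + d' * y))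
      (c * (a' * x + b' * y) + d * (c' * x + d' * y))"
    by (simp add: algebra_simps)
  \<comment> \<open>\<open>lft_hom_point\<close> is used from right to left, for the vector that the
    matrix of \<open>g\<close> produces.\<close>
  also have "\<dots> = lft f (hom_point (a' * x + b' * y) (c' * x + d' * y))"
    using lft_hom_point[OF assms(1)[unfolded f] linear_image_nonzero[OF assms(2)[unfolded g] xy]]
    by (simp only: f)
  also have "\<dots> = lft f (lft g z)"
    using lft_hom_point[OF assms(2)[unfolded g] xy] by (simp only: g z)
  finally show ?thesis .
qed

end
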